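(* For any set $X\in\mathbf P$ and any set $A\subseteq\{0,1\}^+$, we have $\mathcal F^{\preccurlyeq_{\mathrm{nu}}}_{(A,\mathbf{FPT}_{\mathrm{nu}})}=\mathcal F^{\preccurlyeq_{\mathrm{nu}}}_{(A\triangle X,\mathbf{FPT}_{\mathrm{nu}})}$; i.e., for every parameterization $\eta$, $(A,\eta)\in\mathbf{FPT}_{\mathrm{nu}}$ if and only if $(A\triangle X,\eta)\in\mathbf{FPT}_{\mathrm{nu}}$.
   Context: $A\triangle X=(A\setminus X)\cup(X\setminus A)$. A Turing machine $\Phi$ is a partial decision procedure for $A$ if $\Phi(x)=1\Rightarrow x\in A$ and $\Phi(x)=0\Rightarrow x\notin A$; $\mathrm{dom}(\Phi)=\{x:\Phi(x)\in\{0,1\}\}$. An $O(n^c)$-approximation for $A$ is a partial decision procedure for $A$ halting on all inputs in time $O(n^c)$; an $O(n^c)$-slice for $A$ is the domain of one. A parameter space is a nonempty set $\Omega$ with a reflexive, transitive, directed relation and an injective encoding into $\{0,1\}^+$. A parameterization over $\Omega$ is $\eta\subseteq\{0,1\}^+\times\Omega$ such that for every $x$, $\{k:(x,k)\in\eta\}$ is nonempty and upward closed; $\eta_k=\{x:(x,k)\in\eta\}$. $(A,\eta)\in\mathbf{FPT}_{\mathrm{nu}}$ if there is a constant $c$ such that every $\eta_k$ is an $O(n^c)$-slice for $A$. $\mathcal F^{\preccurlyeq_{\mathrm{nu}}}_{(A,\mathbf{FPT}_{\mathrm{nu}})}$ denotes the set of parameterizations $\eta$ with $(A,\eta)\in\mathbf{FPT}_{\mathrm{nu}}$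 (ordered by the nonuniform order). *)

theory Defs
  imports Complex_Main "HOL-Library.Landau_Symbols"
begin

type_synonym word = "bool list"

definition words :: "word set"
  where "words = {x. x \<noteq> []}"


subsection \<open>Turing machines\<close>

text \<open>
  Deterministic multi-tape machines with two-way infinite tapes. States and tape symbols are
  natural numbers drawn from finite sets. Symbol 0 is the blank; the input bits 0 and 1 are
  written as the symbols 1 and 2. The output of a computation is read off the halting
  state, so that a machine may halt with output 1, with output 0, or with any other value
  (no decision).
\<close>

datatype move = MoveLeft | Stay | MoveRight

record tm =
  tm_tapes :: nat
  tm_states :: "nat set"
  tm_symbols :: "nat set"
  tm_start :: nat
  tm_final :: "nat set"
  tm_answer :: "nat \<Rightarrow> nat"
  tm_trans :: "nat \<Rightarrow> nat list \<Rightarrow> nat \<times> (nat \<times> move) list"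

definition turing_machine :: "tm \<Rightarrow> bool"
  where "turing_machine M \<longleftrightarrow>
    tm_tapes M \<ge> 1 \<and>
    finite (tm_states M) \<and> finite (tm_symbols M) \<and> {0, 1, 2} \<subseteq> tm_symbols M \<and>
    tm_start M \<in> tm_states M \<and> tm_final M \<subseteq> tm_states M \<and>
    (\<forall>q \<in> tm_states M - tm_final M. \<forall>ss. length ss = tm_tapes M \<and> set ss \<subseteq> tm_symbols M \<longrightarrow>
       (case tm_trans M q ss of (q', as) \<Rightarrow>
          q' \<in> tm_states M \<and> length as = tm_tapes M \<and> fst ` set as \<subseteq> tm_symbols M))"

text \<open>A tape is its content together with the head position.\<close>

type_synonym tape = "(int \<Rightarrow> nat) \<times> int"

type_synonym config = "nat \<times> tape list"

definition read :: "tape \<Rightarrow> nat"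
  where "read tp = fst tp (snd tp)"

fun shift :: "move \<Rightarrow> int \<Rightarrow> int" where
  "shift MoveLeft p = p - 1"
| "shift Stay p = p"
| "shift MoveRight p = p + 1"

definition act :: "nat \<times> move \<Rightarrow> tape \<Rightarrow> tape"
  where "act a tp = ((fst tp)(snd tp := fst a), shift (snd a) (snd tp))"

definition step :: "tm \<Rightarrow> config \<Rightarrow> config"
  where "step M cf =
    (if fst cf \<in> tm_final M then cf
     else (case tm_trans M (fst cf) (map read (snd cf)) of
             (q', as) \<Rightarrow> (q', map2 act as (snd cf))))"

definition input_tape :: "word \<Rightarrow> tape"
  where "input_tape x =
    ((\<lambda>i. if 0 \<le> i \<and> i < int (length x) then (if x ! nat i then 2 else 1) else 0), 0)"

definition blank_tape :: tape
  where "blank_tape = ((\<lambda>i. 0), 0)"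

definition init :: "tm \<Rightarrow> word \<Rightarrow> config"
  where "init M x = (tm_start M, input_tape x # replicate (tm_tapes M - 1) blank_tape)"

definition state_after :: "tm \<Rightarrow> word \<Rightarrow> nat \<Rightarrow> nat"
  where "state_after M x t = fst ((step M ^^ t) (init M x))"

definition tm_outputs :: "tm \<Rightarrow> word \<Rightarrow> nat \<Rightarrow> bool"
  where "tm_outputs M x v \<longleftrightarrow>
    (\<exists>t. state_after M x t \<in> tm_final M \<and> tm_answer M (state_after M x t) = v)"

text \<open>Halted configurations are fixed by \<^const>\<open>step\<close>, so being in a final state after
  \<open>T n\<close> steps means having halted within \<open>T n\<close> steps.\<close>

definition halts_in_time_O :: "tm \<Rightarrow> nat \<Rightarrow> bool"
  where "halts_in_time_O M c \<longleftrightarrow>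
    (\<exists>T :: nat \<Rightarrow> nat. (\<lambda>n. real (T n)) \<in> O(\<lambda>n. real n ^ c) \<and>
       (\<forall>x \<in> words. state_after M x (T (length x)) \<in> tm_final M))"


subsection \<open>Polynomial time, approximations and slices\<close>

definition class_P :: "word set set"
  where "class_P = {X. X \<subseteq> words \<and>
    (\<exists>M c. turing_machine M \<and> halts_in_time_O M c \<and>
       (\<forall>x \<in> words. (x \<in> X \<longrightarrow> tm_outputs M x 1) \<and> (x \<notin> X \<longrightarrow> tm_outputs M x 0)))}"

definition partial_decision_procedure :: "tm \<Rightarrow> word set \<Rightarrow> bool"
  where "partial_decision_procedure M A \<longleftrightarrow> turing_machine M \<and>
    (\<forall>x \<in> words. (tm_outputs M x 1 \<longrightarrow> x \<in> A) \<and> (tm_outputs M x 0 \<longrightarrow> x \<notin> A))"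

definition tm_dom :: "tm \<Rightarrow> word set"
  where "tm_dom M = {x \<in> words. \<exists>v \<in> {0, 1}. tm_outputs M x v}"

definition approximation :: "nat \<Rightarrow> word set \<Rightarrow> tm \<Rightarrow> bool"
  where "approximation c A M \<longleftrightarrow> partial_decision_procedure M A \<and> halts_in_time_O M c"

definition slice :: "nat \<Rightarrow> word set \<Rightarrow> word set \<Rightarrow> bool"
  where "slice c A S \<longleftrightarrow> (\<exists>M. approximation c A M \<and> S = tm_dom M)"


subsection \<open>Parameterizations\<close>

record 'k param_space =
  params :: "'k set"
  param_le :: "'k \<Rightarrow> 'k \<Rightarrow> bool"
  param_enc :: "'k \<Rightarrow> word"

definition parameter_space :: "'k param_space \<Rightarrow> bool"
  where "parameter_space \<Omega> \<longleftrightarrow>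
    params \<Omega> \<noteq> {} \<and>
    reflp_on (params \<Omega>) (param_le \<Omega>) \<and>
    transp_on (params \<Omega>) (param_le \<Omega>) \<and>
    (\<forall>k \<in> params \<Omega>. \<forall>l \<in> params \<Omega>. \<exists>m \<in> params \<Omega>. param_le \<Omega> k m \<and> param_le \<Omega> l m) \<and>
    inj_on (param_enc \<Omega>) (params \<Omega>) \<and> param_enc \<Omega> ` params \<Omega> \<subseteq> words"

definition parameterization :: "'k param_space \<Rightarrow> (word \<times> 'k) set \<Rightarrow> bool"
  where "parameterization \<Omega> \<eta> \<longleftrightarrow>
    parameter_space \<Omega> \<and> \<eta> \<subseteq> words \<times> params \<Omega> \<and>
    (\<forall>x \<in> words.
       {k. (x, k) \<in> \<eta>} \<noteq> {} \<and>
       (\<forall>k \<in> params \<Omega>. \<forall>l \<in> params \<Omega>. (x, k) \<in> \<eta> \<and> param_le \<Omega> k l \<longrightarrow> (x, l) \<in> \<eta>))"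

definition param_slice :: "(word \<times> 'k) set \<Rightarrow> 'k \<Rightarrow> word set"
  where "param_slice \<eta> k = {x. (x, k) \<in> \<eta>}"

text \<open>A parameterization is carried together with its parameter space.\<close>

definition FPT_nu :: "(word set \<times> 'k param_space \<times> (word \<times> 'k) set) set"
  where "FPT_nu = {(A, \<Omega>, \<eta>). A \<subseteq> words \<and> parameterization \<Omega> \<eta> \<and>
    (\<exists>c. \<forall>k \<in> params \<Omega>. slice c A (param_slice \<eta> k))}"

definition F_nu :: "word set \<Rightarrow> ('k param_space \<times> (word \<times> 'k) set) set"
  where "F_nu A = {(\<Omega>, \<eta>). parameterization \<Omega> \<eta> \<and> (A, \<Omega>, \<eta>) \<in> FPT_nu}"

end

theory Submission
  imports Defs "HOL-Library.Nat_Bijection"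
begin

text \<open>
  Given an approximation of \<open>A\<close> and a polynomial-time decision procedure for \<open>X\<close>, one machine
  first copies its input onto the input tape of the second machine, rewinds both heads, and then
  runs both machines side by side until both have halted. Answering the exclusive or of the two
  verdicts whenever the first machine decides gives an approximation of \<open>A \<triangle> X\<close> with the same
  domain, and the running time grows by a polynomial that depends only on \<open>X\<close>. Since
  \<open>(A \<triangle> X) \<triangle> X = A\<close>, this one construction yields both directions.
\<close>

subsection \<open>Computations\<close>

text \<open>\<open>turing_machine\<close> constrains transitions only on states of the machine,
  symbols of its alphabet and the right number of tapes, so simulating a machine inside a larger one
  needs this invariant of runs.\<close>

definition valid_config :: "tm \<Rightarrow> config \<Rightarrow> bool"
  where "valid_config M cf \<longleftrightarrow> fst cf \<in> tm_states M \<and> length (snd cf) = tm_tapes M \<and>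
    (\<forall>tp \<in> set (snd cf). range (fst tp) \<subseteq> tm_symbols M)"

lemma valid_config_init:
  assumes "turing_machine M"
  shows "valid_config M (init M x)"
  using assms
  by (auto simp: valid_config_def init_def turing_machine_def input_tape_def blank_tape_def)

lemma valid_config_reads:
  assumes "valid_config M (q, tps)"
  shows "set (map read tps) \<subseteq> tm_symbols M"
  using assms by (fastforce simp: valid_config_def read_def)

lemma turing_machine_trans:
  assumes M: "turing_machine M" and "q \<in> tm_states M - tm_final M" "length ss = tm_tapes M"
    "set ss \<subseteq> tm_symbols M" and tr: "tm_trans M q ss = (q', as)"
  shows "q' \<in> tm_states M \<and> length as = tm_tapes M \<and> fst ` set as \<subseteq> tm_symbols M"
proof -
  have "\<forall>q \<in> tm_states M - tm_final M. \<forall>ss. length ss = tm_tapes M \<and> set ss \<subseteq> tm_symbols M \<longrightarrow>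
      (case tm_trans M q ss of (q', as) \<Rightarrow>
        q' \<in> tm_states M \<and> length as = tm_tapes M \<and> fst ` set as \<subseteq> tm_symbols M)"
    using M unfolding turing_machine_def by (elim conjE) assumption
  from this[rule_format, OF assms(2) conjI, OF assms(3,4)] show ?thesis
    unfolding tr by (simp only: prod.case)
qed

lemma valid_config_step:
  assumes M: "turing_machine M" and v: "valid_config M cf"
  shows "valid_config M (step M cf)"
proof (cases "fst cf \<in> tm_final M")
  case True
  then show ?thesis using v by (simp add: step_def)
next
  case False
  obtain q tps where cf: "cf = (q, tps)" by fastforce
  obtain q' as where tr: "tm_trans M q (map read tps) = (q', as)" by fastforce
  have closed: "q' \<in> tm_states M \<and> length as = tm_tapes M \<and> fst ` set as \<subseteq> tm_symbols M"
  proof -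
    have "q \<in> tm_states M - tm_final M" "length (map read tps) = tm_tapes M"
      "set (map read tps) \<subseteq> tm_symbols M"
      using False v valid_config_reads[of M q tps] by (simp_all add: valid_config_def cf)
    with turing_machine_trans[OF M _ _ _ tr] show ?thesis by simp
  qed
  have "range (fst (act a tp)) \<subseteq> tm_symbols M"
    if "a \<in> set as" "tp \<in> set tps" for a tp
  proof -
    have "range (fst tp) \<subseteq> tm_symbols M"
      using v that by (auto simp: valid_config_def cf)
    then show ?thesis using that closed by (auto simp: act_def)
  qed
  then have "range (fst tp) \<subseteq> tm_symbols M" if "tp \<in> set (map2 act as tps)" for tp
    using that by (force elim: in_set_zipE)
  then show ?thesis
    using False v tr closed by (simp add: valid_config_def step_def cf)
qed

lemma step_final: "fst cf \<in> tm_final M \<Longrightarrow> (step M ^^ t) cf = cf"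
  by (induction t) (simp_all add: step_def)

lemma state_after_final_mono:
  assumes "state_after M x s \<in> tm_final M" "s \<le> t"
  shows "state_after M x t = state_after M x s"
proof -
  have "(step M ^^ t) (init M x) = (step M ^^ (t - s)) ((step M ^^ s) (init M x))"
    using assms(2) by (metis comp_apply funpow_add le_add_diff_inverse2)
  then show ?thesis using assms(1) by (simp add: state_after_def step_final)
qed

text \<open>\<open>tm_outputs\<close> quantifies over all times, but a final state is frozen, so
  every halting time yields the same answer and the output is unique.\<close>

lemma tm_outputs_iff_answer:
  assumes "state_after M x t \<in> tm_final M"
  shows "tm_outputs M x v \<longleftrightarrow> tm_answer M (state_after M x t) = v"
proof
  assume "tm_outputs M x v"
  then obtain s where s: "state_after M x s \<in> tm_final M" "tm_answer M (state_after M x s) = v"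
    by (auto simp: tm_outputs_def)
  then show "tm_answer M (state_after M x t) = v"
    using assms state_after_final_mono[of M x] by (metis nle_le)
qed (use assms in \<open>auto simp: tm_outputs_def\<close>)

subsection \<open>Running two machines on the same input\<close>

text \<open>The combined alphabet contains symbols foreign to each component, on which its transition
  function is unconstrained; there the component idles.\<close>

definition sub_trans :: "tm \<Rightarrow> nat \<Rightarrow> nat list \<Rightarrow> nat \<times> (nat \<times> move) list"
  where "sub_trans M q ss =
    (if q \<in> tm_final M \<or> \<not> set ss \<subseteq> tm_symbols M then (q, map (\<lambda>s. (s, Stay)) ss)
     else tm_trans M q ss)"

text \<open>One action serves copying, turning and rewinding: both input tapes receive the same
  symbol and move alike. The work tapes are still blank in these phases, so writing 0 in place
  preserves them.\<close>

definition lockstep :: "tm \<Rightarrow> tm \<Rightarrow> nat \<Rightarrow> move \<Rightarrow> (nat \<times> move) list"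
  where "lockstep M N s m =
    (s, m) # replicate (tm_tapes M - 1) (0, Stay) @ (s, m) # replicate (tm_tapes N - 1) (0, Stay)"

definition run_state :: "nat \<Rightarrow> nat \<Rightarrow> nat"
  where "run_state p q = prod_encode (p, q) + 2"

text \<open>State 0 copies the input, state 1 rewinds, and the remaining states are pairs of states
  of the two machines.\<close>

definition parallel_trans :: "tm \<Rightarrow> tm \<Rightarrow> nat \<Rightarrow> nat list \<Rightarrow> nat \<times> (nat \<times> move) list"
  where "parallel_trans M N q ss =
    (if q = 0 then
       if hd ss = 0 then (1, lockstep M N 0 MoveLeft) else (0, lockstep M N (hd ss) MoveRight)
     else if q = 1 then
       if hd ss = 0 then (run_state (tm_start M) (tm_start N), lockstep M N 0 MoveRight)
       else (1, lockstep M N (hd ss) MoveLeft)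
     else (case prod_decode (q - 2) of (q1, q2) \<Rightarrow>
       (case sub_trans M q1 (take (tm_tapes M) ss) of (r1, as) \<Rightarrow>
       (case sub_trans N q2 (drop (tm_tapes M) ss) of (r2, bs) \<Rightarrow>
         (run_state r1 r2, as @ bs)))))"

text \<open>Both components must be final, so that both verdicts are available to \<open>f\<close>;
  the one that halts first idles through \<open>sub_trans\<close>.\<close>

definition parallel :: "(nat \<Rightarrow> nat \<Rightarrow> nat) \<Rightarrow> tm \<Rightarrow> tm \<Rightarrow> tm"
  where "parallel f M N =
    \<lparr> tm_tapes = tm_tapes M + tm_tapes N,
      tm_states = {0, 1} \<union> case_prod run_state ` (tm_states M \<times> tm_states N),
      tm_symbols = tm_symbols M \<union> tm_symbols N,
      tm_start = 0,
      tm_final = case_prod run_state ` (tm_final M \<times> tm_final N),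
      tm_answer = (\<lambda>q. case prod_decode (q - 2) of (p, r) \<Rightarrow> f (tm_answer M p) (tm_answer N r)),
      tm_trans = parallel_trans M N \<rparr>"

section \<open>Well-formedness of the combined machine\<close>

lemma run_state_inject [simp]: "run_state p q = run_state p' q' \<longleftrightarrow> p = p' \<and> q = q'"
  by (simp add: run_state_def)

lemma run_state_neq [simp]:
  "run_state p q \<noteq> 0" "run_state p q \<noteq> Suc 0" "0 \<noteq> run_state p q" "Suc 0 \<noteq> run_state p q"
  by (simp_all add: run_state_def)

lemma run_state_decode [simp]: "prod_decode (run_state p q - 2) = (p, q)"
  by (simp add: run_state_def)

lemma parallel_final_iff [simp]:
  "run_state p q \<in> tm_final (parallel f M N) \<longleftrightarrow> p \<in> tm_final M \<and> q \<in> tm_final N"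
  "0 \<notin> tm_final (parallel f M N)" "Suc 0 \<notin> tm_final (parallel f M N)"
  by (auto simp: parallel_def)

text \<open>The symbols read enter the bound because idling writes them back even when they are
  foreign to \<open>M\<close>.\<close>

lemma sub_trans_closed:
  assumes "turing_machine M" "q \<in> tm_states M" "length ss = tm_tapes M" "sub_trans M q ss = (r, as)"
  shows "r \<in> tm_states M" "length as = tm_tapes M" "fst ` set as \<subseteq> tm_symbols M \<union> set ss"
proof -
  have "r \<in> tm_states M \<and> length as = tm_tapes M \<and> fst ` set as \<subseteq> tm_symbols M \<union> set ss"
  proof (cases "q \<in> tm_final M \<or> \<not> set ss \<subseteq> tm_symbols M")
    case True
    then show ?thesis using assms by (auto simp: sub_trans_def)
  next
    case False
    then have "tm_trans M q ss = (r, as)" using assms by (auto simp: sub_trans_def)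
    from turing_machine_trans[OF assms(1) _ assms(3) _ this] assms(2) False
    show ?thesis by auto
  qed
  then show "r \<in> tm_states M" "length as = tm_tapes M" "fst ` set as \<subseteq> tm_symbols M \<union> set ss"
    by auto
qed

lemma lockstep_closed:
  assumes "turing_machine M" "turing_machine N"
  shows "length (lockstep M N s m) = tm_tapes M + tm_tapes N"
    "fst ` set (lockstep M N s m) \<subseteq> {0, s}"
  using assms by (auto simp: lockstep_def turing_machine_def)

text \<open>Final states of a component cannot be excluded here: one machine may have halted while
  the other still runs. Idling keeps \<open>sub_trans\<close> closed in that case.\<close>

lemma parallel_trans_closed:
  assumes M: "turing_machine M" and N: "turing_machine N"
    and q: "q \<in> tm_states (parallel f M N)"
    and ss: "length ss = tm_tapes M + tm_tapes N" "set ss \<subseteq> tm_symbols M \<union> tm_symbols N"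
    and tr: "parallel_trans M N q ss = (q', as)"
  shows "q' \<in> tm_states (parallel f M N) \<and> length as = tm_tapes M + tm_tapes N \<and>
    fst ` set as \<subseteq> tm_symbols M \<union> tm_symbols N"
proof -
  have z: "0 \<in> tm_symbols M" "tm_tapes M \<ge> 1" "tm_start M \<in> tm_states M" "tm_start N \<in> tm_states N"
    using M N by (auto simp: turing_machine_def)
  then have "ss \<noteq> []" using ss by auto
  then have h: "hd ss \<in> tm_symbols M \<union> tm_symbols N" using ss(2) hd_in_set by blast
  consider "q = 0 \<or> q = 1" | q1 q2 where "q = run_state q1 q2" "q1 \<in> tm_states M" "q2 \<in> tm_states N"
    using q by (auto simp: parallel_def)
  then show ?thesis
  proof cases
    case 1
    have "q' \<in> tm_states (parallel f M N)"
      using 1 tr z by (auto simp: parallel_trans_def parallel_def split: if_splits)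
    moreover obtain s m where "as = lockstep M N s m" "s \<in> {0, hd ss}"
      using 1 tr by (auto simp: parallel_trans_def split: if_splits)
    ultimately show ?thesis using lockstep_closed[OF M N, of s m] z h by auto
  next
    case 2
    obtain r1 as1 where t1: "sub_trans M q1 (take (tm_tapes M) ss) = (r1, as1)" by fastforce
    obtain r2 as2 where t2: "sub_trans N q2 (drop (tm_tapes M) ss) = (r2, as2)" by fastforce
    have "q' = run_state r1 r2" "as = as1 @ as2"
      using tr t1 t2 2(1) by (auto simp: parallel_trans_def)
    moreover have "r1 \<in> tm_states M" "length as1 = tm_tapes M"
        "fst ` set as1 \<subseteq> tm_symbols M \<union> set (take (tm_tapes M) ss)"
      using sub_trans_closed[OF M 2(2) _ t1] ss by auto
    moreover have "r2 \<in> tm_states N" "length as2 = tm_tapes N"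
        "fst ` set as2 \<subseteq> tm_symbols N \<union> set (drop (tm_tapes M) ss)"
      using sub_trans_closed[OF N 2(3) _ t2] ss by auto
    moreover have "set (take (tm_tapes M) ss) \<subseteq> tm_symbols M \<union> tm_symbols N"
        "set (drop (tm_tapes M) ss) \<subseteq> tm_symbols M \<union> tm_symbols N"
      using set_take_subset set_drop_subset ss(2) by (meson order_trans)+
    ultimately have "fst ` set as \<subseteq> tm_symbols M \<union> tm_symbols N"
      unfolding \<open>as = _\<close> set_append image_Un by (meson Un_least Un_upper1 Un_upper2 order_trans)
    moreover have "run_state r1 r2 \<in> tm_states (parallel f M N)"
      using \<open>r1 \<in> tm_states M\<close> \<open>r2 \<in> tm_states N\<close> by (auto simp: parallel_def)
    ultimately show ?thesis
      using \<open>q' = _\<close> \<open>as = _\<close> \<open>length as1 = _\<close> \<open>length as2 = _\<close> by simp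
  qed
qed

lemma turing_machine_parallel:
  assumes M: "turing_machine M" and N: "turing_machine N"
  shows "turing_machine (parallel f M N)"
proof -
  have "case tm_trans (parallel f M N) q ss of (q', as) \<Rightarrow>
      q' \<in> tm_states (parallel f M N) \<and> length as = tm_tapes (parallel f M N) \<and>
      fst ` set as \<subseteq> tm_symbols (parallel f M N)"
    if "q \<in> tm_states (parallel f M N)" "length ss = tm_tapes (parallel f M N)"
      "set ss \<subseteq> tm_symbols (parallel f M N)" for q ss
  proof -
    obtain q' as where "parallel_trans M N q ss = (q', as)" by fastforce
    with parallel_trans_closed[OF M N that(1) _ _ this] that show ?thesis
      by (auto simp: parallel_def)
  qed
  moreover have "finite (tm_states (parallel f M N))" "finite (tm_symbols (parallel f M N))"
      "{0, 1, 2} \<subseteq> tm_symbols (parallel f M N)" "tm_tapes (parallel f M N) \<ge> 1"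
      "tm_start (parallel f M N) \<in> tm_states (parallel f M N)"
      "tm_final (parallel f M N) \<subseteq> tm_states (parallel f M N)"
    using M N unfolding turing_machine_def by (auto simp: parallel_def)
  ultimately show ?thesis unfolding turing_machine_def by (intro conjI ballI allI impI) simp_all
qed

section \<open>Simulation of both machines side by side\<close>

definition join_config :: "config \<Rightarrow> config \<Rightarrow> config"
  where "join_config cf cg = (run_state (fst cf) (fst cg), snd cf @ snd cg)"

lemma map2_act_stay: "map2 act (map (\<lambda>s. (s, Stay)) (map read tps)) tps = tps"
  by (induction tps) (auto simp: act_def read_def)

text \<open>On a valid configuration no foreign symbol is read, so \<open>sub_trans\<close> idles
  only in final states, where \<open>step\<close> fixes the configuration as well.\<close>

lemma sub_trans_step:
  assumes "valid_config M (q, tps)" "sub_trans M q (map read tps) = (r, as)"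
  shows "step M (q, tps) = (r, map2 act as tps)"
  using assms valid_config_reads[OF assms(1)] map2_act_stay[of tps]
  by (auto simp: sub_trans_def step_def split: if_splits)

lemma step_parallel_join:
  assumes M: "turing_machine M" and N: "turing_machine N"
    and v: "valid_config M cf" "valid_config N cg"
  shows "step (parallel f M N) (join_config cf cg) = join_config (step M cf) (step N cg)"
proof (cases "fst cf \<in> tm_final M \<and> fst cg \<in> tm_final N")
  case True
  then show ?thesis by (simp add: join_config_def step_def)
next
  case False
  obtain q1 u1 q2 u2 where c: "cf = (q1, u1)" "cg = (q2, u2)" by fastforce
  obtain r1 as1 where t1: "sub_trans M q1 (map read u1) = (r1, as1)" by fastforce
  obtain r2 as2 where t2: "sub_trans N q2 (map read u2) = (r2, as2)" by fastforce
  have l: "length u1 = tm_tapes M" "length u2 = tm_tapes N" "q1 \<in> tm_states M" "q2 \<in> tm_states N"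
    using v by (auto simp: valid_config_def c)
  \<comment> \<open>Equal lengths let the zip over the concatenated tapes split at the border
    between the two machines.\<close>
  have "length as1 = length u1"
    using sub_trans_closed(2)[OF M l(3) _ t1] l by simp
  moreover have "tm_trans (parallel f M N) (run_state q1 q2) (map read (u1 @ u2))
      = (run_state r1 r2, as1 @ as2)"
    using l t1 t2 by (simp add: parallel_def parallel_trans_def)
  ultimately show ?thesis
    using False sub_trans_step[OF v(1)[unfolded c] t1] sub_trans_step[OF v(2)[unfolded c] t2]
    by (auto simp: c join_config_def step_def[of "parallel f M N"])
qed

lemma steps_parallel_join:
  assumes M: "turing_machine M" and N: "turing_machine N"
    and v: "valid_config M cf" "valid_config N cg"
  shows "(step (parallel f M N) ^^ t) (join_config cf cg)
    = join_config ((step M ^^ t) cf) ((step N ^^ t) cg)"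
proof (induction t)
  case (Suc t)
  have "valid_config M ((step M ^^ t) cf)" "valid_config N ((step N ^^ t) cg)"
    using v valid_config_step M N by (induction t) auto
  with Suc show ?case by (simp add: step_parallel_join[OF M N])
qed simp

subsection \<open>Copying the input\<close>

definition copy_config :: "tm \<Rightarrow> tm \<Rightarrow> nat \<Rightarrow> tape \<Rightarrow> tape \<Rightarrow> config"
  where "copy_config M N q tp up =
    (q, tp # replicate (tm_tapes M - 1) blank_tape @ up # replicate (tm_tapes N - 1) blank_tape)"

lemma step_copy_config:
  assumes "q = 0 \<or> q = 1" "parallel_trans M N q (read tp # ss) = (r, lockstep M N s m)"
    and "ss = map read (replicate (tm_tapes M - 1) blank_tape @ up #
      replicate (tm_tapes N - 1) blank_tape)"
  shows "step (parallel f M N) (copy_config M N q tp up)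
    = copy_config M N r (act (s, m) tp) (act (s, m) up)"
proof -
  have [simp]: "act (0, Stay) blank_tape = blank_tape"
    by (simp add: act_def blank_tape_def fun_eq_iff)
  have [simp]: "map2 act (replicate k (0, Stay)) (replicate k blank_tape) = replicate k blank_tape" for k
    by (simp add: zip_replicate)
  have "tm_trans (parallel f M N) = parallel_trans M N"
    by (simp add: parallel_def)
  then show ?thesis
    using assms by (auto simp: copy_config_def step_def lockstep_def)
qed

lemma step_copying:
  "step (parallel f M N) (copy_config M N 0 tp up) =
    (if read tp = 0 then copy_config M N 1 (act (0, MoveLeft) tp) (act (0, MoveLeft) up)
     else copy_config M N 0 (act (read tp, MoveRight) tp) (act (read tp, MoveRight) up))"
  by (auto intro!: step_copy_config simp: parallel_trans_def)

lemma step_rewinding: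
  "step (parallel f M N) (copy_config M N 1 tp up) =
    (if read tp = 0 then copy_config M N (run_state (tm_start M) (tm_start N))
       (act (0, MoveRight) tp) (act (0, MoveRight) up)
     else copy_config M N 1 (act (read tp, MoveLeft) tp) (act (read tp, MoveLeft) up))"
  by (auto intro!: step_copy_config simp: parallel_trans_def)

abbreviation input_cells :: "word \<Rightarrow> int \<Rightarrow> nat"
  where "input_cells x \<equiv> fst (input_tape x)"

text \<open>Bits are written as 1 and 2, so reading a blank detects both ends of the input; this is
  what stops the copying and the rewinding.\<close>

lemma input_cells_eq_0_iff: "input_cells x i = 0 \<longleftrightarrow> \<not> (0 \<le> i \<and> i < int (length x))"
  by (simp add: input_tape_def)

lemma input_cells_take_Suc:
  assumes "t < length x"
  shows "(input_cells (take t x))(int t := input_cells x (int t)) = input_cells (take (Suc t) x)"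
  using assms by (auto simp: input_tape_def fun_eq_iff nat_less_iff)

lemma copying_steps:
  assumes M: "turing_machine M" and N: "turing_machine N" and "t \<le> length x"
  shows "(step (parallel f M N) ^^ t) (init (parallel f M N) x)
    = copy_config M N 0 (input_cells x, int t) (input_cells (take t x), int t)"
  using assms(3)
proof (induction t)
  case 0
  obtain k l where kl: "tm_tapes M = Suc k" "tm_tapes N = Suc l"
    using M N unfolding turing_machine_def by (metis not0_implies_Suc not_one_le_zero)
  have "init (parallel f M N) x = copy_config M N 0 (input_tape x) blank_tape"
    using replicate_add[of k "Suc l" blank_tape]
    by (simp add: init_def parallel_def copy_config_def kl)
  \<comment> \<open>A blank tape carries the empty word, which is the copied prefix at time
    0.\<close>
  moreover have "input_tape x = (input_cells x, 0)" "blank_tape = (input_cells [], 0)"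
    by (simp_all add: input_tape_def blank_tape_def fun_eq_iff)
  ultimately show ?case by simp
next
  case (Suc t)
  then have "input_cells x (int t) \<noteq> 0" by (simp add: input_cells_eq_0_iff)
  with Suc show ?case
    by (simp add: step_copying read_def act_def input_cells_take_Suc add.commute)
qed

text \<open>The start is cell \<open>length x - 1\<close> because the step that meets the blank
  behind the input already moves left. Every bit passed is written back, so only the heads change;
  \<open>j = length x\<close> puts them on cell -1.\<close>

lemma rewinding_steps:
  assumes "j \<le> length x"
  shows "(step (parallel f M N) ^^ j)
      (copy_config M N 1 (input_cells x, int (length x) - 1) (input_cells x, int (length x) - 1))
    = copy_config M N 1 (input_cells x, int (length x) - 1 - int j)
        (input_cells x, int (length x) - 1 - int j)"
  using assms
proof (induction j)
  case (Suc j)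
  then have "input_cells x (int (length x) - 1 - int j) \<noteq> 0" by (simp add: input_cells_eq_0_iff)
  with Suc show ?case
    by (simp add: step_rewinding[unfolded One_nat_def] read_def act_def algebra_simps)
qed simp

text \<open>The count is \<open>length x\<close> steps of copying, one to turn at the right blank,
  \<open>length x\<close> steps of rewinding, and one from cell -1 back to cell 0.\<close>

lemma copy_phase:
  assumes M: "turing_machine M" and N: "turing_machine N"
  shows "(step (parallel f M N) ^^ (2 * length x + 2)) (init (parallel f M N) x)
    = join_config (init M x) (init N x)"
proof -
  let ?P = "parallel f M N" and ?n = "length x"
  let ?c = "\<lambda>i. (input_cells x, i)"
  \<comment> \<open>Both turning steps write a blank onto a cell that is blank already.\<close>
  have upd: "(input_cells x)(i := 0) = input_cells x" if "input_cells x i = 0" for i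
    using that by auto
  have out: "input_cells x (int ?n) = 0" "input_cells x (- 1) = 0"
    by (simp_all add: input_cells_eq_0_iff)
  have "(step ?P ^^ ?n) (init ?P x) = copy_config M N 0 (?c (int ?n)) (?c (int ?n))"
    using copying_steps[OF M N, of ?n x f] by simp
  then have "(step ?P ^^ Suc ?n) (init ?P x) = copy_config M N 1 (?c (int ?n - 1)) (?c (int ?n - 1))"
    using out upd by (simp add: step_copying read_def act_def)
  then have "(step ?P ^^ (?n + Suc ?n)) (init ?P x) = copy_config M N 1 (?c (- 1)) (?c (- 1))"
    using rewinding_steps[of ?n x f M N] by (simp only: funpow_add comp_apply) simp
  then have "(step ?P ^^ Suc (?n + Suc ?n)) (init ?P x)
      = copy_config M N (run_state (tm_start M) (tm_start N)) (?c 0) (?c 0)"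
    using out upd by (simp only: funpow.simps comp_apply step_rewinding) (simp add: read_def act_def)
  also have "\<dots> = join_config (init M x) (init N x)"
    by (simp add: copy_config_def join_config_def init_def input_tape_def)
  finally show ?thesis by (simp add: mult_2)
qed

section \<open>Output and running time of the combined machine\<close>

lemma state_after_parallel:
  assumes "turing_machine M" "turing_machine N"
  shows "state_after (parallel f M N) x (2 * length x + 2 + t)
    = run_state (state_after M x t) (state_after N x t)"
proof -
  have "(step (parallel f M N) ^^ (t + (2 * length x + 2))) (init (parallel f M N) x)
      = join_config ((step M ^^ t) (init M x)) ((step N ^^ t) (init N x))"
    using copy_phase[OF assms, of x f]
      steps_parallel_join[OF assms valid_config_init valid_config_init, OF assms]
    by (simp only: funpow_add comp_apply)
  then show ?thesis by (simp add: state_after_def join_config_def add.commute)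
qed

lemma tm_outputs_parallel:
  assumes MN: "turing_machine M" "turing_machine N" and "tm_outputs M x u" "tm_outputs N x v"
  shows "tm_outputs (parallel f M N) x w \<longleftrightarrow> w = f u v"
proof -
  obtain s t where s: "state_after M x s \<in> tm_final M" "tm_answer M (state_after M x s) = u"
    and t: "state_after N x t \<in> tm_final N" "tm_answer N (state_after N x t) = v"
    using assms(3,4) by (auto simp: tm_outputs_def)
  \<comment> \<open>After the copy phase, \<open>s + t\<close> further steps are past both halting
    times, and the final states reached at \<open>s\<close> and \<open>t\<close> persist until
    then.\<close>
  let ?r = "2 * length x + 2 + (s + t)"
  have eq: "state_after (parallel f M N) x ?r = run_state (state_after M x s) (state_after N x t)"
    unfolding state_after_parallel[OF MN]
    using state_after_final_mono[OF s(1), of "s + t"] state_after_final_mono[OF t(1), of "s + t"]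
    by simp
  then have "state_after (parallel f M N) x ?r \<in> tm_final (parallel f M N)"
    using s t by simp
  from tm_outputs_iff_answer[OF this] show ?thesis
    unfolding eq using s t by (auto simp: parallel_def)
qed

lemma power_bigo_mono:
  assumes "a \<le> b"
  shows "(\<lambda>n. real n ^ a) \<in> O(\<lambda>n. real n ^ b)"
proof (rule bigoI[where c = 1])
  show "eventually (\<lambda>n. norm (real n ^ a) \<le> 1 * norm (real n ^ b)) at_top"
    \<comment> \<open>The bound is only eventual: at \<open>n = 0\<close> it fails when
      \<open>a = 0 < b\<close>.\<close>
    using eventually_ge_at_top[of 1]
    by eventually_elim (use assms in \<open>auto intro!: power_increasing\<close>)
qed

text \<open>The exponent \<open>c + d + 1\<close> dominates \<open>c\<close>, \<open>d\<close> and
  the exponent 1 of the linear copy phase at once.\<close>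

lemma halts_in_time_O_parallel:
  assumes MN: "turing_machine M" "turing_machine N"
    and "halts_in_time_O M c" "halts_in_time_O N d"
  shows "halts_in_time_O (parallel f M N) (c + d + 1)"
proof -
  obtain S T :: "nat \<Rightarrow> nat"
    where S: "(\<lambda>n. real (S n)) \<in> O(\<lambda>n. real n ^ c)"
        "\<And>x. x \<in> words \<Longrightarrow> state_after M x (S (length x)) \<in> tm_final M"
      and T: "(\<lambda>n. real (T n)) \<in> O(\<lambda>n. real n ^ d)"
        "\<And>x. x \<in> words \<Longrightarrow> state_after N x (T (length x)) \<in> tm_final N"
    using assms(3,4) unfolding halts_in_time_O_def by blast
  \<comment> \<open>The sum of the two time bounds stands in for their maximum, so that the growth
    can be estimated term by term.\<close>
  define U where "U = (\<lambda>n. 2 * n + 2 + (S n + T n))"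
  have "(\<lambda>n. 2 * real n ^ 1) \<in> O(\<lambda>n. real n ^ (c + d + 1))"
       "(\<lambda>n. 2 * real n ^ 0) \<in> O(\<lambda>n. real n ^ (c + d + 1))"
    using power_bigo_mono[of 1 "c + d + 1"] power_bigo_mono[of 0 "c + d + 1"] by simp_all
  moreover have "(\<lambda>n. real (S n)) \<in> O(\<lambda>n. real n ^ (c + d + 1))"
    by (rule landau_o.big_trans[OF S(1) power_bigo_mono]) simp
  moreover have "(\<lambda>n. real (T n)) \<in> O(\<lambda>n. real n ^ (c + d + 1))"
    by (rule landau_o.big_trans[OF T(1) power_bigo_mono]) simp
  ultimately have "(\<lambda>n. 2 * real n ^ 1 + 2 * real n ^ 0 + (real (S n) + real (T n)))
      \<in> O(\<lambda>n. real n ^ (c + d + 1))"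
    by (intro sum_in_bigo)
  then have "(\<lambda>n. real (U n)) \<in> O(\<lambda>n. real n ^ (c + d + 1))"
    by (simp add: U_def algebra_simps)
  moreover have "state_after (parallel f M N) x (U (length x)) \<in> tm_final (parallel f M N)"
    if "x \<in> words" for x
    unfolding U_def state_after_parallel[OF MN]
    using S(2)[OF that] T(2)[OF that]
      state_after_final_mono[OF S(2)[OF that], of "S (length x) + T (length x)"]
      state_after_final_mono[OF T(2)[OF that], of "S (length x) + T (length x)"]
    by simp
  ultimately show ?thesis unfolding halts_in_time_O_def by blast
qed

subsection \<open>Symmetric differences\<close>

text \<open>The value 2 stands for ``no decision''.\<close>

definition xor_answer :: "nat \<Rightarrow> nat \<Rightarrow> nat"
  where "xor_answer u v = (if u \<le> 1 then (u + v) mod 2 else 2)"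

text \<open>\<open>N\<close> decides every word, so \<open>xor_answer\<close> is 0 or 1 exactly when
  the verdict of \<open>M\<close> is. Hence the domain is preserved along with correctness.\<close>

lemma slice_sym_diff:
  assumes N: "turing_machine N" "halts_in_time_O N d"
    and X: "\<And>x. x \<in> words \<Longrightarrow> tm_outputs N x (if x \<in> X then 1 else 0)"
    and "slice c A S"
  shows "slice (c + d + 1) (sym_diff A X) S"
proof -
  obtain M where M: "turing_machine M" "halts_in_time_O M c" and S: "S = tm_dom M"
    and A: "\<And>x. x \<in> words \<Longrightarrow> (tm_outputs M x 1 \<longrightarrow> x \<in> A) \<and> (tm_outputs M x 0 \<longrightarrow> x \<notin> A)"
    using assms(4) unfolding slice_def approximation_def partial_decision_procedure_def by blast
  let ?P = "parallel xor_answer M N"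
  \<comment> \<open>An approximation halts on every word and so has exactly one output
    \<open>u\<close>, possibly undecided. Correctness and the domain then reduce to a case
    distinction on \<open>u\<close>.\<close>
  have answers: "\<exists>u. (\<forall>w. tm_outputs M x w \<longleftrightarrow> w = u) \<and>
      (\<forall>w. tm_outputs ?P x w \<longleftrightarrow> w = xor_answer u (if x \<in> X then 1 else 0))"
    if x: "x \<in> words" for x
  proof -
    obtain t where t: "state_after M x t \<in> tm_final M"
      using M(2) x unfolding halts_in_time_O_def by blast
    have u: "\<forall>w. tm_outputs M x w \<longleftrightarrow> w = tm_answer M (state_after M x t)"
      using tm_outputs_iff_answer[OF t] by auto
    with tm_outputs_parallel[OF M(1) N(1) _ X[OF x]] show ?thesis by blast
  qed
  have "(tm_outputs ?P x 1 \<longrightarrow> x \<in> sym_diff A X) \<and> (tm_outputs ?P x 0 \<longrightarrow> x \<notin> sym_diff A X)"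
    if x: "x \<in> words" for x
  proof -
    obtain u where u: "\<forall>w. tm_outputs M x w \<longleftrightarrow> w = u"
      "\<forall>w. tm_outputs ?P x w \<longleftrightarrow> w = xor_answer u (if x \<in> X then 1 else 0)"
      using answers[OF x] by blast
    \<comment> \<open>For \<open>u > 1\<close> the combined output is 2, and both implications are
      vacuous.\<close>
    consider "u = 0" | "u = 1" | "u > 1" by linarith
    then show ?thesis
      by cases (use A[OF x] u in \<open>auto simp: xor_answer_def\<close>)
  qed
  then have "approximation (c + d + 1) (sym_diff A X) ?P"
    using turing_machine_parallel[OF M(1) N(1)]
      halts_in_time_O_parallel[OF M(1) N(1) M(2) N(2)]
    by (auto simp: approximation_def partial_decision_procedure_def)
  moreover have "tm_dom ?P = tm_dom M"
  proof -
    have "(\<exists>v\<in>{0, 1}. tm_outputs ?P x v) \<longleftrightarrow> (\<exists>v\<in>{0, 1}. tm_outputs M x v)"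
      if x: "x \<in> words" for x
    proof -
      obtain u where u: "\<forall>w. tm_outputs M x w \<longleftrightarrow> w = u"
        "\<forall>w. tm_outputs ?P x w \<longleftrightarrow> w = xor_answer u (if x \<in> X then 1 else 0)"
        using answers[OF x] by blast
      consider "u = 0" | "u = 1" | "u > 1" by linarith
      then show ?thesis
        by cases (use u in \<open>auto simp: xor_answer_def\<close>)
    qed
    then show ?thesis unfolding tm_dom_def by blast
  qed
  ultimately show ?thesis unfolding slice_def S by metis
qed

text \<open>The exponent \<open>d\<close> comes from \<open>X\<close> alone and is fixed before the
  parameter, so \<open>c + d + 1\<close> is again uniform over all slices.\<close>

lemma FPT_nu_sym_diff:
  assumes "X \<in> class_P" "(A, \<Omega>, \<eta>) \<in> FPT_nu"
  shows "(sym_diff A X, \<Omega>, \<eta>) \<in> FPT_nu"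
proof -
  obtain N d where N: "turing_machine N" "halts_in_time_O N d"
    and X: "\<And>x. x \<in> words \<Longrightarrow> tm_outputs N x (if x \<in> X then 1 else 0)" and "X \<subseteq> words"
  proof -
    obtain N d where "turing_machine N" "halts_in_time_O N d" "X \<subseteq> words"
      and "\<forall>x \<in> words. (x \<in> X \<longrightarrow> tm_outputs N x 1) \<and> (x \<notin> X \<longrightarrow> tm_outputs N x 0)"
      using assms(1) unfolding class_P_def by blast
    then show ?thesis using that[of N d] by simp
  qed
  obtain c where "A \<subseteq> words" "parameterization \<Omega> \<eta>"
    and "\<And>k. k \<in> params \<Omega> \<Longrightarrow> slice c A (param_slice \<eta> k)"
    using assms(2) unfolding FPT_nu_def by blast
  then show ?thesis
    using slice_sym_diff[OF N X] \<open>X \<subseteq> words\<close> unfolding FPT_nu_def by blast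
qed

lemma FPT_nu_sym_diff_iff:
  assumes "X \<in> class_P"
  shows "(sym_diff A X, \<Omega>, \<eta>) \<in> FPT_nu \<longleftrightarrow> (A, \<Omega>, \<eta>) \<in> FPT_nu"
proof
  assume "(sym_diff A X, \<Omega>, \<eta>) \<in> FPT_nu"
  moreover have "sym_diff (sym_diff A X) X = A" by blast
  ultimately show "(A, \<Omega>, \<eta>) \<in> FPT_nu"
    using FPT_nu_sym_diff[OF assms] by metis
qed (rule FPT_nu_sym_diff[OF assms])

theorem theorem7:
  fixes X A :: "word set"
  assumes "X \<in> class_P" and "A \<subseteq> words"
  shows "(F_nu A :: ('k param_space \<times> (word \<times> 'k) set) set) = F_nu (sym_diff A X)
    \<and> (\<forall>(\<Omega> :: 'k param_space) \<eta>. parameterization \<Omega> \<eta> \<longrightarrow>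
         ((A, \<Omega>, \<eta>) \<in> FPT_nu \<longleftrightarrow> (sym_diff A X, \<Omega>, \<eta>) \<in> FPT_nu))"
  \<comment> \<open>Rewriting turns membership for \<open>sym_diff A X\<close> into membership for
    \<open>A\<close>, which makes the two sides of each conjunct coincide.\<close>
  unfolding F_nu_def FPT_nu_sym_diff_iff[OF assms(1)] by blast

end
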